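(* Let $n>1$ be an integer and let $x,y\in\mathbb{R}^n$ be such that $|x-y|$ is an algebraic number. Then there exists a finite set $S_{xy}\subseteq\mathbb{R}^n$ containing $x$ and $y$ such that every map $f:S_{xy}\to\mathbb{R}^n$ preserving all unit distances satisfies $|f(x)-f(y)|=|x-y|$.
   Context: $|\cdot|$ is the Euclidean norm on $\mathbb{R}^n$. A map $f:S\to\mathbb{R}^n$ with $S\subseteq\mathbb{R}^n$ preserves all unit distances if for all $u,v\in S$, $|u-v|=1$ implies $|f(u)-f(v)|=1$. Maps are arbitrary functions (no continuity or injectivity is assumed). *)

theory Defs
  imports "HOL-Analysis.Analysis" "HOL-Computational_Algebra.Polynomial"
begin

text \<open>
  A map \<open>S \<rightarrow> \<real>\<^sup>n\<close> is represented by a total function, of which only the values on \<open>S\<close> are used.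
\<close>

definition preserves_unit_distances_on ::
  "(real ^ 'n) set \<Rightarrow> (real ^ 'n \<Rightarrow> real ^ 'n) \<Rightarrow> bool" where
  "preserves_unit_distances_on S f \<longleftrightarrow>
     (\<forall>u\<in>S. \<forall>v\<in>S. norm (u - v) = 1 \<longrightarrow> norm (f u - f v) = 1)"

end

(*
The properties of f forced by preserving unit distances on some finite set form a filter; call d
rigid if it forces |f X - f Y| = d whenever |X - Y| = d. Gluing two regular simplices along a facet
(with a spindle to exclude folding) shows that with a also sqrt (2 + 2/n) a and (1 + 2/n) a are
rigid; these lengths fit together on a line and give 2a, hence all multiples, and by intercepts all
nonnegative rationals. As rational distances are dense, f almost preserves any given distance.

This approximation excludes degenerate foldings of linkages, so f preserves midpoints along a
coordinate axis, and Peaucellier's inversor shows that H s = f (s e) - f 0 satisfies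
H (1/s) = H s / |H s|^2. Additivity and inversion force H s = g(s) H 1 with g additive and
g(1/s) = 1/g(s), so g is multiplicative as well. If s is a root of an integer polynomial then so is
g(s), and g(s) is close to s, whence g(s) = s.
*)

theory Submission
  imports Defs
begin

section \<open>Forced properties and rigid distances\<close>

text \<open>"Some finite set forces P" becomes \<open>eventually P unit_filter\<close>. Finite sets
  then need not be written down: finitely many forced properties combine by the filter laws, and
  approximate statements become limits.\<close>

definition unit_filter :: "(real ^ 'n \<Rightarrow> real ^ 'n) filter" where
  "unit_filter = (INF S\<in>{S. finite S}. principal {f. preserves_unit_distances_on S f})"

lemma eventually_unit_filter:
  "eventually P unit_filter \<longleftrightarrow>
     (\<exists>S. finite S \<and> (\<forall>f. preserves_unit_distances_on S f \<longrightarrow> P f))"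
proof -
  have "eventually P unit_filter \<longleftrightarrow>
    (\<exists>S\<in>{S. finite S}. eventually P (principal {f. preserves_unit_distances_on S f}))"
    unfolding unit_filter_def
  proof (rule eventually_INF_base)
    fix S T :: "(real ^ 'n) set"
    assume "S \<in> {S. finite S}" "T \<in> {S. finite S}"
    then show "\<exists>R\<in>{S. finite S}. principal {f. preserves_unit_distances_on R f}
        \<le> inf (principal {f. preserves_unit_distances_on S f})
              (principal {f. preserves_unit_distances_on T f})"
      by (intro bexI[of _ "S \<union> T"]) (auto simp: preserves_unit_distances_on_def)
  qed auto
  then show ?thesis by (simp add: eventually_principal)
qed

text \<open>If S forces P on \<open>f\<close>, then the image of S under \<open>g\<close> forces P
  on \<open>f \<circ> g\<close>, because \<open>g\<close> carries unit distances in S to unit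
  distances.\<close>

lemma eventually_compose_isometry:
  assumes iso: "\<And>u v. dist (g u) (g v) = dist u v"
    and ev: "eventually P unit_filter"
  shows "eventually (\<lambda>f. P (f \<circ> g)) unit_filter"
proof -
  obtain S where S: "finite S" "\<And>f. preserves_unit_distances_on S f \<Longrightarrow> P f"
    using ev by (auto simp: eventually_unit_filter)
  have "preserves_unit_distances_on S (f \<circ> g)" if "preserves_unit_distances_on (g ` S) f" for f
    using that iso by (auto simp: preserves_unit_distances_on_def simp flip: dist_norm)
  with S show ?thesis
    unfolding eventually_unit_filter by (intro exI[of _ "g ` S"]) auto
qed

lemma isometry_between_pairs:
  fixes X Y X' Y' :: "real ^ 'n"
  assumes "dist X Y = dist X' Y'"
  obtains g where "\<And>u v. dist (g u) (g v) = dist u v" "g X = X'" "g Y = Y'"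
proof -
  have "norm (Y - X) = norm (Y' - X')"
    using assms by (simp add: dist_norm norm_minus_commute)
  then obtain T where T: "orthogonal_transformation T" "T (Y - X) = Y' - X'"
    using orthogonal_transformation_exists by metis
  have lin: "linear T" using T(1) orthogonal_transformation_linear by blast
  show ?thesis
  proof
    show "dist (X' + T (u - X)) (X' + T (v - X)) = dist u v" for u v
    proof -
      have "T (u - X) - T (v - X) = T (u - v)" by (simp add: lin linear_diff[symmetric])
      then show ?thesis using T(1) by (simp add: dist_norm orthogonal_transformation_norm)
    qed
  qed (use T lin in \<open>auto simp: linear_0\<close>)
qed

text \<open>A linkage built for one pair of points can be moved to any congruent pair, so each
  distance needs only one construction.\<close>

lemma eventually_pair_transfer:
  fixes X Y X' Y' :: "real ^ 'n"
  assumes "eventually (\<lambda>f. Q (f X) (f Y)) unit_filter" "dist X Y = dist X' Y'"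
  shows "eventually (\<lambda>f. Q (f X') (f Y')) unit_filter"
proof -
  obtain g where g: "\<And>u v. dist (g u) (g v) = dist u v" "g X = X'" "g Y = Y'"
    using isometry_between_pairs[OF assms(2)] by blast
  from eventually_compose_isometry[OF g(1) assms(1)] g(2,3) show ?thesis by simp
qed

text \<open>The number d does not determine the dimension, hence the type argument.\<close>

definition rigid :: "'n::finite itself \<Rightarrow> real \<Rightarrow> bool" where
  "rigid _ d \<longleftrightarrow>
     (\<forall>X Y :: real ^ 'n. dist X Y = d \<longrightarrow> eventually (\<lambda>f. dist (f X) (f Y) = d) unit_filter)"

lemma rigidD:
  fixes X Y :: "real ^ 'n"
  assumes "rigid TYPE('n) d" "dist X Y = d"
  shows "eventually (\<lambda>f. dist (f X) (f Y) = d) unit_filter"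
  using assms by (auto simp: rigid_def)

lemma rigidI:
  fixes X Y :: "real ^ 'n"
  assumes "eventually (\<lambda>f. dist (f X) (f Y) = d) unit_filter" "dist X Y = d"
  shows "rigid TYPE('n) d"
  unfolding rigid_def
proof (intro allI impI)
  fix X' Y' :: "real ^ 'n" assume "dist X' Y' = d"
  then have "dist X Y = dist X' Y'" using assms(2) by simp
  with eventually_pair_transfer[of "\<lambda>a b. dist a b = d", OF assms(1)]
  show "eventually (\<lambda>f. dist (f X') (f Y') = d) unit_filter" by blast
qed

lemma rigid_1: "rigid TYPE('n::finite) 1"
  unfolding rigid_def eventually_unit_filter
proof (intro allI impI)
  fix X Y :: "real ^ 'n" assume "dist X Y = 1"
  then show "\<exists>S. finite S \<and> (\<forall>f. preserves_unit_distances_on S f \<longrightarrow> dist (f X) (f Y) = 1)"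
    by (intro exI[of _ "{X, Y}"]) (auto simp: preserves_unit_distances_on_def dist_norm)
qed

text \<open>The apex lies over the midpoint at height
  \<open>sqrt (r\<^sup>2 - (dist U V / 2)\<^sup>2)\<close>, in a perpendicular direction that exists
  since the dimension exceeds 1. The case U = V is included.\<close>

lemma ex_isosceles:
  fixes U V :: "real ^ 'n"
  assumes n: "CARD('n) > 1" and r: "dist U V \<le> 2 * r"
  obtains Z where "dist Z U = r" "dist Z V = r"
proof -
  have "2 \<le> DIM(real ^ 'n)" using n by simp
  then obtain w0 where w0: "w0 \<noteq> 0" "orthogonal (U - V) w0"
    using orthogonal_to_vector_exists by blast
  define h where "h = sqrt (r\<^sup>2 - (dist U V / 2)\<^sup>2)"
  define w where "w = (h / norm w0) *\<^sub>R w0"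
  have r0: "0 \<le> r" using r zero_le_dist[of U V] by linarith
  have "(dist U V / 2)\<^sup>2 \<le> r\<^sup>2" using r r0 by (intro power_mono) auto
  then have "norm w ^ 2 = r\<^sup>2 - (dist U V / 2)\<^sup>2" using w0 by (simp add: w_def h_def)
  then have ww: "w \<bullet> w = r\<^sup>2 - (U - V) \<bullet> (U - V) / 4"
    by (simp add: power2_norm_eq_inner dist_norm power_divide)
  have wo: "(U - V) \<bullet> w = 0" using w0 by (simp add: w_def orthogonal_def)
  define M where "M = (1/2) *\<^sub>R (U + V)"
  have e: "M + w - U = w - (1/2) *\<^sub>R (U - V)" "M + w - V = w + (1/2) *\<^sub>R (U - V)"
    by (simp_all add: M_def vec_eq_iff) (simp_all add: field_simps)
  have "norm (M + w - U) ^ 2 = r\<^sup>2" "norm (M + w - V) ^ 2 = r\<^sup>2"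
    unfolding e power2_norm_eq_inner using wo ww
    by (simp_all add: inner_diff_left inner_diff_right inner_add_left inner_add_right inner_commute field_simps)
  then show ?thesis
    using that[of "M + w"] r0 by (simp add: dist_norm)
qed

section \<open>Regular simplices\<close>

text \<open>Indexing the facet by the coordinate type yields exactly n facet vertices, and with the
  apex the n + 1 vertices of a full-dimensional simplex.\<close>

definition regular_simplex :: "real \<Rightarrow> ('n \<Rightarrow> real ^ 'n) \<Rightarrow> real ^ 'n \<Rightarrow> bool" where
  "regular_simplex a p x \<longleftrightarrow>
     (\<forall>i j. i \<noteq> j \<longrightarrow> dist (p i) (p j) = a) \<and> (\<forall>i. dist x (p i) = a)"

text \<open>For a regular simplex the perpendicular from x meets the facet in its centroid, so this
  point reflection in the centroid is the mirror image of x in the facet.\<close>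

definition opposite_apex :: "('n \<Rightarrow> real ^ 'n) \<Rightarrow> real ^ 'n \<Rightarrow> real ^ 'n" where
  "opposite_apex p x = (2 / real CARD('n)) *\<^sub>R (\<Sum>i\<in>UNIV. p i) - x"

text \<open>By dimension the n independent vectors span the space, so w is a combination of them and
  hence orthogonal to itself.\<close>

lemma orthogonal_to_independent_family:
  fixes q :: "'n::finite \<Rightarrow> real ^ 'n"
  assumes indep: "\<And>c :: real ^ 'n. (\<Sum>i\<in>UNIV. (c $ i) *\<^sub>R q i) = 0 \<Longrightarrow> c = 0"
    and orth: "\<And>i. w \<bullet> q i = 0"
  shows "w = 0"
proof -
  define L where "L = (\<lambda>c :: real ^ 'n. \<Sum>i\<in>UNIV. (c $ i) *\<^sub>R q i)"
  have lin: "linear L"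
    unfolding L_def
    by (intro linearI) (simp_all add: scaleR_add_left sum.distrib scaleR_sum_right)
  have "inj L"
    using indep lin by (auto simp: L_def linear_injective_0)
  then obtain c where c: "w = L c"
    using linear_injective_imp_surjective[OF lin] by (metis surjD)
  have "w \<bullet> L c = 0"
    using orth by (simp add: L_def inner_sum_right)
  then show ?thesis using c by simp
qed

context
  fixes a :: real and p :: "'n::finite \<Rightarrow> real ^ 'n" and x :: "real ^ 'n"
  assumes a: "a > 0" and reg: "regular_simplex a p x"
begin

text \<open>Polarization; the edges at x thus have Gram matrix (I + J) times a^2 / 2, with J the
  all-ones matrix, and the following lemmas are computed from it.\<close>

lemma simplex_gram: "(p i - x) \<bullet> (p j - x) = (if i = j then a\<^sup>2 else a\<^sup>2 / 2)"
proof -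
  have n: "norm (p k - x) = a" for k
    using reg by (simp add: regular_simplex_def dist_norm norm_minus_commute)
  have n2: "norm ((p i - x) - (p j - x)) = a" if "i \<noteq> j"
    using reg that by (simp add: regular_simplex_def dist_norm)
  show ?thesis
  proof (cases "i = j")
    case True
    then show ?thesis using n[of j] by (simp flip: power2_norm_eq_inner)
  next
    case False
    have "(p i - x) \<bullet> (p j - x) =
        ((norm (p i - x))\<^sup>2 + (norm (p j - x))\<^sup>2 - (norm ((p i - x) - (p j - x)))\<^sup>2) / 2"
      by (rule dot_norm_neg)
    then show ?thesis using n n2[OF False] False by simp
  qed
qed

lemma simplex_sum_inner:
  "(\<Sum>i\<in>UNIV. p i - x) \<bullet> (p j - x) = a\<^sup>2 * (real CARD('n) + 1) / 2"
proof -
  have "(\<Sum>i\<in>UNIV. p i - x) \<bullet> (p j - x) = (\<Sum>i\<in>UNIV. a\<^sup>2 / 2 + (if i = j then a\<^sup>2 / 2 else 0))"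
    unfolding inner_sum_left by (intro sum.cong) (auto simp: simplex_gram)
  also have "\<dots> = a\<^sup>2 * (real CARD('n) + 1) / 2"
    by (simp add: sum.distrib sum.delta algebra_simps add_divide_distrib)
  finally show ?thesis .
qed

lemma simplex_sum_norm:
  "(\<Sum>i\<in>UNIV. p i - x) \<bullet> (\<Sum>i\<in>UNIV. p i - x) = real CARD('n) * (a\<^sup>2 * (real CARD('n) + 1) / 2)"
proof -
  let ?s = "\<Sum>i\<in>UNIV. p i - x"
  have "?s \<bullet> ?s = (\<Sum>j\<in>UNIV. ?s \<bullet> (p j - x))" by (rule inner_sum_right)
  then show ?thesis by (simp only: simplex_sum_inner) simp
qed

text \<open>The Gram matrix is nonsingular: in a linear dependence each coefficient equals minus the
  sum s of all, whence (1 + n) s = 0.\<close>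

lemma simplex_orthogonal:
  assumes "\<And>i. w \<bullet> (p i - x) = 0" shows "w = 0"
proof (rule orthogonal_to_independent_family)
  fix c :: "real ^ 'n"
  define v where "v = (\<Sum>i\<in>UNIV. (c $ i) *\<^sub>R (p i - x))"
  define s where "s = (\<Sum>i\<in>UNIV. c $ i)"
  assume "(\<Sum>i\<in>UNIV. (c $ i) *\<^sub>R (p i - x)) = 0"
  then have v0: "v = 0" by (simp add: v_def)
  have vj: "v \<bullet> (p j - x) = a\<^sup>2 / 2 * (s + c $ j)" for j
  proof -
    have "v \<bullet> (p j - x) = (\<Sum>i\<in>UNIV. c $ i * (a\<^sup>2 / 2) + (if i = j then c $ j * (a\<^sup>2 / 2) else 0))"
      unfolding v_def inner_sum_left by (intro sum.cong) (auto simp: simplex_gram)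
    then show ?thesis
      by (simp add: sum.distrib sum.delta s_def algebra_simps flip: sum_distrib_left sum_distrib_right sum_divide_distrib)
  qed
  have cj: "c $ j = - s" for j
    using vj[of j] v0 a by simp
  have "s = (\<Sum>j\<in>(UNIV :: 'n set). - s)"
    by (subst (1) s_def) (intro sum.cong refl cj)
  then have "s = - (real CARD('n) * s)" by simp
  then have "(1 + real CARD('n)) * s = 0" by (simp add: algebra_simps)
  then have "s = 0" by (simp add: add_nonneg_eq_0_iff)
  then show "c = 0" using cj by (simp add: vec_eq_iff)
qed (fact assms)

lemma opposite_apex_diff:
  "opposite_apex p x - x = (2 / real CARD('n)) *\<^sub>R (\<Sum>i\<in>UNIV. p i - x)"
proof -
  have "(\<Sum>i\<in>UNIV. p i - x) = (\<Sum>i\<in>UNIV. p i) - real CARD('n) *\<^sub>R x"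
    by (simp only: sum_subtractf sum_constant_scaleR)
  then show ?thesis by (simp add: opposite_apex_def scaleR_diff_right scaleR_2)
qed

lemma dist_opposite_apex: "dist x (opposite_apex p x) = sqrt (2 + 2 / real CARD('n)) * a"
proof -
  have "(norm (opposite_apex p x - x))\<^sup>2 = (2 + 2 / real CARD('n)) * a\<^sup>2"
    unfolding power2_norm_eq_inner opposite_apex_diff
    by (simp add: simplex_sum_norm power2_eq_square field_simps)
  then have "norm (opposite_apex p x - x) = sqrt ((2 + 2 / real CARD('n)) * a\<^sup>2)"
    by (metis norm_ge_zero real_sqrt_unique)
  then show ?thesis
    using a by (simp add: dist_norm norm_minus_commute real_sqrt_mult)
qed

text \<open>The sphere of radius a around \<open>p i\<close> passes through x, so its equation in y
  - x has no constant term.\<close>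

lemma dist_eq_iff_inner:
  "dist y (p i) = a \<longleftrightarrow> (y - x) \<bullet> (y - x) = 2 * ((y - x) \<bullet> (p i - x))"
proof -
  have "dist y (p i) = norm ((y - x) - (p i - x))" by (simp add: dist_norm)
  then have "(dist y (p i))\<^sup>2 = (y - x) \<bullet> (y - x) - 2 * ((y - x) \<bullet> (p i - x)) + a\<^sup>2"
    using simplex_gram[of i i]
    by (simp only: power2_norm_eq_inner inner_diff_left inner_diff_right inner_commute) simp
  moreover have "dist y (p i) = a \<longleftrightarrow> (dist y (p i))\<^sup>2 = a\<^sup>2" using a by simp
  ultimately show ?thesis by linarith
qed

lemma dist_opposite_apex_facet: "dist (opposite_apex p x) (p i) = a"
  unfolding dist_eq_iff_inner opposite_apex_diff
  by (simp add: simplex_sum_norm simplex_sum_inner)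

lemma regular_simplex_opposite_apex: "regular_simplex a p (opposite_apex p x)"
  using reg dist_opposite_apex_facet by (simp add: regular_simplex_def)

text \<open>All edges have the same inner product with y - x, which makes y - x a multiple k of the
  sum of the edges. The sphere equation is then quadratic in k, with roots 0 and 2/n.\<close>

lemma apex_cases:
  assumes "\<And>i. dist y (p i) = a"
  shows "y = x \<or> y = opposite_apex p x"
proof -
  let ?n = "real CARD('n)"
  let ?s = "\<Sum>i\<in>UNIV. p i - x"
  define w where "w = y - x"
  have wi: "w \<bullet> w = 2 * (w \<bullet> (p i - x))" for i
    using assms[of i] unfolding dist_eq_iff_inner w_def by simp
  \<comment> \<open>Chosen so that k times the edge sum has inner product
    \<open>w \<bullet> w / 2\<close> with each edge, as w does.\<close>
  define k where "k = w \<bullet> w / (a\<^sup>2 * (?n + 1))"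
  have npos: "?n + 1 > 0" by simp
  have "w - k *\<^sub>R ?s = 0"
  proof (rule simplex_orthogonal)
    show "(w - k *\<^sub>R ?s) \<bullet> (p i - x) = 0" for i
    proof -
      have "k * (a\<^sup>2 * (?n + 1) / 2) = w \<bullet> w / 2" using a npos by (simp add: k_def)
      then show ?thesis using wi[of i] by (simp add: inner_diff_left simplex_sum_inner)
    qed
  qed
  then have wk: "w = k *\<^sub>R ?s" by simp
  then have "w \<bullet> w = k * k * (?n * (a\<^sup>2 * (?n + 1) / 2))" by (simp add: simplex_sum_norm)
  moreover have "w \<bullet> w = k * (a\<^sup>2 * (?n + 1))" using a npos by (simp add: k_def)
  ultimately have "k * (a\<^sup>2 * (?n + 1)) * (k * ?n / 2 - 1) = 0" by (simp add: algebra_simps)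
  then have "k = 0 \<or> k * ?n = 2" using a npos by auto
  then have "k = 0 \<or> k = 2 / ?n" by (auto simp: field_simps)
  then show ?thesis
  proof
    assume "k = 0" then show ?thesis using wk by (simp add: w_def)
  next
    assume "k = 2 / ?n"
    then have "y - x = opposite_apex p x - x" using wk unfolding opposite_apex_diff by (simp add: w_def)
    then show ?thesis by simp
  qed
qed

end

lemma ex_regular_simplex:
  assumes "a > 0"
  obtains p :: "'n::finite \<Rightarrow> real ^ 'n" and x where "regular_simplex a p x"
proof -
  let ?n = "real CARD('n)"
  define s where "s = a / sqrt 2"
  have s: "s > 0" "2 * s\<^sup>2 = a\<^sup>2" using assms by (simp_all add: s_def power_divide)
  define p where "p = (\<lambda>i :: 'n. axis i s :: real ^ 'n)"
  \<comment> \<open>The positive root of n t^2 - 2 t s - s^2 = 0, which says that (t, ..., t) has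
    distance a from each s e_i, given 2 s^2 = a^2.\<close>
  define t where "t = (s + s * sqrt (1 + ?n)) / ?n"
  define x where "x = (\<chi> i :: 'n. t)"
  have n0: "?n > 0" by simp
  have "(?n * t - s)\<^sup>2 = s\<^sup>2 * (1 + ?n)" by (simp add: t_def power_mult_distrib)
  then have "?n * (?n * t\<^sup>2 - 2 * t * s - s\<^sup>2) = 0" by (simp add: power2_eq_square algebra_simps)
  then have t: "?n * t\<^sup>2 - 2 * t * s - s\<^sup>2 = 0" by simp
  have "dist (p i) (p j) = a" if "i \<noteq> j" for i j
  proof -
    have "(norm (p i - p j))\<^sup>2 = a\<^sup>2"
      unfolding power2_norm_eq_inner using that s
      by (simp add: p_def inner_diff_left inner_diff_right inner_axis_axis power2_eq_square)
    then show ?thesis using assms by (simp add: dist_norm)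
  qed
  moreover have "dist x (p i) = a" for i
  proof -
    have "x \<bullet> x = ?n * t\<^sup>2" by (simp add: x_def inner_vec_def power2_eq_square)
    moreover have "x \<bullet> p i = t * s" "p i \<bullet> x = t * s"
      by (simp_all add: x_def p_def inner_axis inner_axis' )
    moreover have "p i \<bullet> p i = s\<^sup>2" by (simp add: p_def inner_axis_axis power2_eq_square)
    ultimately have "(norm (x - p i))\<^sup>2 = a\<^sup>2"
      unfolding power2_norm_eq_inner using s t by (simp add: algebra_simps)
    then show ?thesis using assms by (simp add: dist_norm)
  qed
  ultimately show ?thesis using that[of p x] by (simp add: regular_simplex_def)
qed

section \<open>Images of glued simplices and the distances they make rigid\<close>

lemma eventually_regular_simplex:
  fixes p :: "'n::finite \<Rightarrow> real ^ 'n"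
  assumes "rigid TYPE('n) a" "regular_simplex a p x"
  shows "eventually (\<lambda>f. regular_simplex a (\<lambda>i. f (p i)) (f x)) unit_filter"
proof -
  have "eventually (\<lambda>f. \<forall>i. dist (f x) (f (p i)) = a) unit_filter"
    using assms by (intro eventually_all_finite rigidD) (auto simp: regular_simplex_def)
  moreover have "eventually (\<lambda>f. \<forall>i j. i \<noteq> j \<longrightarrow> dist (f (p i)) (f (p j)) = a) unit_filter"
  proof (intro eventually_all_finite)
    fix i j
    show "eventually (\<lambda>f. i \<noteq> j \<longrightarrow> dist (f (p i)) (f (p j)) = a) unit_filter"
      using assms by (cases "i = j") (auto simp: regular_simplex_def rigidD)
  qed
  ultimately show ?thesis
    by eventually_elim (simp add: regular_simplex_def)
qed

text \<open>The images of two simplices sharing a facet share a facet again, so the two apexes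
  either coincide or are l apart. A spindle rules out the first case.\<close>

lemma rigid_double_height:
  assumes n: "CARD('n::finite) > 1" and a: "a > 0" and K: "rigid TYPE('n) a"
  shows "rigid TYPE('n) (sqrt (2 + 2 / real CARD('n)) * a)"
proof -
  define l where "l = sqrt (2 + 2 / real CARD('n)) * a"
  have la: "a < l"
    using a by (simp add: l_def add_pos_pos)
  have two_values: "eventually (\<lambda>f. f X = f Y \<or> dist (f X) (f Y) = l) unit_filter"
    if "dist X Y = l" for X Y :: "real ^ 'n"
  proof -
    obtain p :: "'n \<Rightarrow> real ^ 'n" and x where px: "regular_simplex a p x"
      using ex_regular_simplex[OF a] by blast
    let ?y = "opposite_apex p x"
    have "eventually (\<lambda>f. f x = f ?y \<or> dist (f x) (f ?y) = l) unit_filter"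
      using eventually_regular_simplex[OF K px]
        eventually_regular_simplex[OF K regular_simplex_opposite_apex[OF a px]]
    proof eventually_elim
      case (elim f)
      have "f ?y = f x \<or> f ?y = opposite_apex (\<lambda>i. f (p i)) (f x)"
        using elim(2) by (intro apex_cases[OF a elim(1)]) (simp add: regular_simplex_def)
      then show ?case
        using dist_opposite_apex[OF a elim(1)] by (auto simp: l_def)
    qed
    moreover have "dist x ?y = dist X Y"
      using dist_opposite_apex[OF a px] that by (simp add: l_def)
    ultimately show ?thesis
      using eventually_pair_transfer[of "\<lambda>u v. u = v \<or> dist u v = l"] by blast
  qed
  define U :: "real ^ 'n" where "U = 0"
  obtain V where UV: "dist U V = a"
    using vector_choose_dist[of a U] a by auto
  \<comment> \<open>U and V are a apart and both l from Z. If \<open>f Z = f U\<close>, then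
    \<open>f Z\<close> and \<open>f V\<close> would be a apart, but only 0 and l are possible and 0
    < a < l.\<close>
  obtain Z where Z: "dist Z U = l" "dist Z V = l"
    using ex_isosceles[OF n, of U V l] UV la a by auto
  have "eventually (\<lambda>f. dist (f Z) (f U) = l) unit_filter"
    using two_values[OF Z(1)] two_values[OF Z(2)] rigidD[OF K UV]
    by eventually_elim (use la a in auto)
  then show ?thesis using Z(1) rigidI unfolding l_def by blast
qed

text \<open>With the folded position excluded by the rigid double height, \<open>f\<close> commutes
  with reflection in a facet.\<close>

lemma eventually_opposite_apex:
  fixes p :: "'n::finite \<Rightarrow> real ^ 'n"
  assumes n: "CARD('n) > 1" and a: "a > 0" and K: "rigid TYPE('n) a"
    and px: "regular_simplex a p x"
  shows "eventually (\<lambda>f. f (opposite_apex p x) = opposite_apex (\<lambda>i. f (p i)) (f x)) unit_filter"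
  using eventually_regular_simplex[OF K px]
    eventually_regular_simplex[OF K regular_simplex_opposite_apex[OF a px]]
    rigidD[OF rigid_double_height[OF n a K] dist_opposite_apex[OF a px]]
proof eventually_elim
  case (elim f)
  have "f (opposite_apex p x) \<noteq> f x"
    using elim(3) a by (auto simp: add_nonneg_eq_0_iff)
  moreover have "f (opposite_apex p x) = f x \<or> f (opposite_apex p x) = opposite_apex (\<lambda>i. f (p i)) (f x)"
    using elim(2) by (intro apex_cases[OF a elim(1)]) (simp add: regular_simplex_def)
  ultimately show ?case by simp
qed

text \<open>Reflecting \<open>x\<close> to \<open>y\<close> and then a vertex \<open>p k\<close> to \<open>z\<close> yields
  \<open>z - x = (1 + 2/n) (y - p k)\<close>.\<close>

lemma rigid_trapezoid:
  assumes n: "CARD('n::finite) > 1" and a: "a > 0" and K: "rigid TYPE('n) a"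
  shows "rigid TYPE('n) ((1 + 2 / real CARD('n)) * a)"
proof -
  obtain p :: "'n \<Rightarrow> real ^ 'n" and x where px: "regular_simplex a p x"
    using ex_regular_simplex[OF a] by blast
  fix k :: 'n
  let ?n = "real CARD('n)"
  define y where "y = opposite_apex p x"
  define p' where "p' = p(k := y)"
  define z where "z = opposite_apex p' (p k)"
  have py: "regular_simplex a p y"
    unfolding y_def by (rule regular_simplex_opposite_apex[OF a px])
  have p': "regular_simplex a p' (p k)"
    using py by (auto simp: regular_simplex_def p'_def dist_commute)
  \<comment> \<open>An identity for arbitrary points, so it applies to the simplex as well as to its
    image under \<open>f\<close>.\<close>
  have key: "opposite_apex (q(k := opposite_apex q u)) (q k) - u
      = (1 + 2 / ?n) *\<^sub>R (opposite_apex q u - q k)" for q :: "'n \<Rightarrow> real ^ 'n" and u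
  proof -
    define S where "S = (\<Sum>i\<in>UNIV - {k}. q i)"
    have "(\<Sum>i\<in>UNIV. q i) = q k + S" unfolding S_def by (subst sum.remove[of _ k]) auto
    moreover have "(\<Sum>i\<in>UNIV. (q(k := v)) i) = v + S" for v
      unfolding S_def by (subst sum.remove[of _ k]) auto
    ultimately show ?thesis
      by (simp only: opposite_apex_def) (simp add: vec_eq_iff field_simps)
  qed
  have "eventually (\<lambda>f. dist (f x) (f z) = (1 + 2 / ?n) * a) unit_filter"
    using eventually_opposite_apex[OF n a K px] eventually_opposite_apex[OF n a K p']
      eventually_regular_simplex[OF K py]
  proof eventually_elim
    case (elim f)
    let ?q = "\<lambda>i. f (p i)"
    have "(\<lambda>i. f (p' i)) = ?q(k := opposite_apex ?q (f x))"
      using elim(1) by (auto simp: p'_def y_def)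
    then have "f z - f x = (1 + 2 / ?n) *\<^sub>R (f y - f (p k))"
      using key[of ?q "f x"] elim(1,2) by (simp add: z_def y_def)
    moreover have "norm (f y - f (p k)) = a"
      using elim(3) by (simp add: regular_simplex_def dist_norm)
    ultimately show ?case using a by (simp add: dist_norm norm_minus_commute[of "f x"])
  qed
  moreover have "dist x z = (1 + 2 / ?n) * a"
  proof -
    have "z - x = (1 + 2 / ?n) *\<^sub>R (y - p k)"
      using key[of p x] by (simp add: z_def y_def p'_def)
    moreover have "norm (y - p k) = a" using py by (simp add: regular_simplex_def dist_norm)
    ultimately show ?thesis using a by (simp add: dist_norm norm_minus_commute[of x])
  qed
  ultimately show ?thesis by (rule rigidI)
qed

section \<open>Rational distances\<close>

text \<open>The equality case of the triangle inequality, kept free of division.\<close>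

lemma between_by_dist:
  fixes A B C :: "'a::real_inner"
  assumes "dist A B = s" "dist B C = t" "dist A C = s + t"
  shows "(s + t) *\<^sub>R (B - A) = s *\<^sub>R (C - A)"
proof -
  have "norm (A - B) *\<^sub>R (B - C) = norm (B - C) *\<^sub>R (A - B)"
    using assms by (simp flip: dist_triangle_eq)
  then have "s *\<^sub>R (B - C) = t *\<^sub>R (A - B)" using assms by (simp add: dist_norm)
  then show ?thesis by (simp add: algebra_simps)
qed

text \<open>Besides \<open>a\<close> and \<open>r a\<close> also \<open>(1 + r) a\<close> is rigid, because
  \<open>1 + r = 2 + 2/n\<close> is the square of the factor in \<open>rigid_double_height\<close>.\<close>

lemma eventually_collinear:
  fixes X v :: "real ^ 'n"
  assumes n: "CARD('n) > 1" and a: "a > 0" and K: "rigid TYPE('n) a" and v: "norm v = a"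
    and r: "r = 1 + 2 / real CARD('n)"
  shows "eventually (\<lambda>f. f (X + r *\<^sub>R v) = f X + r *\<^sub>R (f (X + v) - f X) \<and>
           f (X + (1 + r) *\<^sub>R v) = f X + (1 + r) *\<^sub>R (f (X + v) - f X)) unit_filter"
proof -
  have r0: "r > 0" by (simp add: r add_pos_nonneg)
  have Kr: "rigid TYPE('n) (r * a)"
    unfolding r by (rule rigid_trapezoid[OF n a K])
  have l: "sqrt (2 + 2 / real CARD('n)) > 0" by (simp add: add_pos_nonneg)
  have "rigid TYPE('n) (sqrt (2 + 2 / real CARD('n)) * (sqrt (2 + 2 / real CARD('n)) * a))"
    using a l by (intro rigid_double_height n K) auto
  then have K1r: "rigid TYPE('n) ((1 + r) * a)"
    by (simp add: r mult.assoc[symmetric])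
  have d: "dist (X + s *\<^sub>R v) (X + t *\<^sub>R v) = \<bar>s - t\<bar> * a" for s t
    using v by (simp add: dist_norm flip: scaleR_diff_left)
  have "dist (X + 0 *\<^sub>R v) (X + 1 *\<^sub>R v) = a" "dist (X + 0 *\<^sub>R v) (X + r *\<^sub>R v) = r * a"
    "dist (X + 0 *\<^sub>R v) (X + (1 + r) *\<^sub>R v) = (1 + r) * a"
    "dist (X + 1 *\<^sub>R v) (X + (1 + r) *\<^sub>R v) = r * a" "dist (X + r *\<^sub>R v) (X + (1 + r) *\<^sub>R v) = a"
    unfolding d using r0 by simp_all
  then have D: "dist X (X + v) = a" "dist X (X + r *\<^sub>R v) = r * a"
    "dist X (X + (1 + r) *\<^sub>R v) = (1 + r) * a"
    "dist (X + v) (X + (1 + r) *\<^sub>R v) = r * a" "dist (X + r *\<^sub>R v) (X + (1 + r) *\<^sub>R v) = a"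
    by simp_all
  show ?thesis
    using rigidD[OF K D(1)] rigidD[OF Kr D(2)] rigidD[OF K1r D(3)] rigidD[OF Kr D(4)] rigidD[OF K D(5)]
  proof eventually_elim
    case (elim f)
    let ?C = "f (X + (1 + r) *\<^sub>R v)"
    \<comment> \<open>The parameters 0, 1, 1 + r and 0, r, 1 + r both give degenerate triangles with
      rigid sides, so all four image points lie on one line.\<close>
    have "(a + r * a) *\<^sub>R (f (X + v) - f X) = a *\<^sub>R (?C - f X)"
      using elim by (intro between_by_dist) (auto simp: algebra_simps)
    moreover have "a + r * a = a * (1 + r)" by (simp add: algebra_simps)
    ultimately have "a *\<^sub>R ((1 + r) *\<^sub>R (f (X + v) - f X)) = a *\<^sub>R (?C - f X)"
      by simp
    then have 1: "(1 + r) *\<^sub>R (f (X + v) - f X) = ?C - f X"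
      using a scaleR_cancel_left[of a] by blast
    have "(r * a + a) *\<^sub>R (f (X + r *\<^sub>R v) - f X) = (r * a) *\<^sub>R (?C - f X)"
      using elim by (intro between_by_dist) (auto simp: algebra_simps)
    moreover have "r * a + a = a * (1 + r)" "r * a * (1 + r) = a * (1 + r) * r"
      by (simp_all add: algebra_simps)
    ultimately have "(a * (1 + r)) *\<^sub>R (f (X + r *\<^sub>R v) - f X) = (a * (1 + r)) *\<^sub>R (r *\<^sub>R (f (X + v) - f X))"
      unfolding 1[symmetric] scaleR_scaleR by simp
    then have "(a * (1 + r)) *\<^sub>R (f (X + r *\<^sub>R v) - f X - r *\<^sub>R (f (X + v) - f X)) = 0"
      by (simp add: scaleR_diff_right)
    moreover have "a * (1 + r) \<noteq> 0" using a r0 by simp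
    ultimately have "f (X + r *\<^sub>R v) - f X = r *\<^sub>R (f (X + v) - f X)"
      by (metis scaleR_eq_0_iff right_minus_eq)
    with 1 show ?case by (simp add: algebra_simps)
  qed
qed

text \<open>The point X + (1 + r) v is reached from X + v both by the configuration starting at X
  and by the one starting at X + v. Comparing the two expressions for its image shows that
  consecutive steps have equal images.\<close>

lemma eventually_double_step:
  fixes X v :: "real ^ 'n"
  assumes n: "CARD('n) > 1" and K: "rigid TYPE('n) (norm v)"
  shows "eventually (\<lambda>f. f (X + 2 *\<^sub>R v) - f (X + v) = f (X + v) - f X) unit_filter"
proof (cases "v = 0")
  case False
  define r where "r = 1 + 2 / real CARD('n)"
  have r0: "r > 0" by (simp add: r_def add_pos_nonneg)
  have a: "norm v > 0" using False by simp
  show ?thesis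
    using eventually_collinear[OF n a K refl r_def, of X]
      eventually_collinear[OF n a K refl r_def, of "X + v"]
  proof eventually_elim
    case (elim f)
    have e: "X + v + v = X + 2 *\<^sub>R v" "X + v + r *\<^sub>R v = X + (1 + r) *\<^sub>R v"
      by (simp_all add: algebra_simps scaleR_2)
    have "r *\<^sub>R (f (X + 2 *\<^sub>R v) - f (X + v)) = f (X + (1 + r) *\<^sub>R v) - f (X + v)"
      using elim(2) unfolding e by simp
    also have "\<dots> = r *\<^sub>R (f (X + v) - f X)"
      using elim(1) by (simp add: algebra_simps)
    finally show ?case using r0 by simp
  qed
qed simp

lemma eventually_multiple_step:
  fixes X v :: "real ^ 'n"
  assumes n: "CARD('n) > 1" and K: "rigid TYPE('n) (norm v)"
  shows "eventually (\<lambda>f. f (X + real N *\<^sub>R v) - f X = real N *\<^sub>R (f (X + v) - f X)) unit_filter"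
proof -
  \<comment> \<open>Bounding k keeps this a finite conjunction, which is what a filter
    allows.\<close>
  have "eventually (\<lambda>f. \<forall>k\<in>{..<N}. f (X + real k *\<^sub>R v + 2 *\<^sub>R v) - f (X + real k *\<^sub>R v + v)
      = f (X + real k *\<^sub>R v + v) - f (X + real k *\<^sub>R v)) unit_filter"
    by (intro eventually_ball_finite ballI eventually_double_step n K) auto
  then show ?thesis
  proof eventually_elim
    case (elim f)
    have step: "f (X + real (Suc k) *\<^sub>R v) - f (X + real k *\<^sub>R v) = f (X + v) - f X" if "k \<le> N" for k
      using that
    proof (induction k)
      case (Suc k)
      have e: "X + real k *\<^sub>R v + 2 *\<^sub>R v = X + real (Suc (Suc k)) *\<^sub>R v"
        "X + real k *\<^sub>R v + v = X + real (Suc k) *\<^sub>R v"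
        by (simp_all add: algebra_simps scaleR_2)
      show ?case using elim[rule_format, of k] Suc unfolding e by simp
    qed simp
    have "f (X + real k *\<^sub>R v) - f X = real k *\<^sub>R (f (X + v) - f X)" if "k \<le> N" for k
      using that
    proof (induction k)
      case (Suc k)
      then have "f (X + real (Suc k) *\<^sub>R v) - f X = (f (X + v) - f X) + real k *\<^sub>R (f (X + v) - f X)"
        using step[of k] by (metis (no_types, lifting) Suc_leD add_diff_eq diff_add_cancel)
      then show ?case by (simp add: scaleR_add_left)
    qed simp
    then show ?case by blast
  qed
qed

lemma rigid_of_nat:
  assumes n: "CARD('n::finite) > 1"
  shows "rigid TYPE('n) (real N)"
proof -
  obtain v :: "real ^ 'n" where v: "norm v = 1" using vector_choose_size[of 1] by auto
  have K: "rigid TYPE('n) (norm v)" using rigid_1 v by simp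
  have "eventually (\<lambda>f. dist (f v) (f 0) = 1) unit_filter"
    using v by (intro rigidD rigid_1) (simp add: dist_norm)
  with eventually_multiple_step[OF n K, of 0 N]
  have "eventually (\<lambda>f. dist (f 0) (f (real N *\<^sub>R v)) = real N) unit_filter"
  proof eventually_elim
    case (elim f)
    then show ?case using v by (simp add: dist_norm norm_minus_commute[of "f 0"])
  qed
  then show ?thesis by (rule rigidI) (simp add: v)
qed

text \<open>Intercept theorem: stretching a triangle N-fold from its apex Z turns the base d into N
  d, which is rigid by assumption.\<close>

lemma rigid_divide:
  assumes n: "CARD('n::finite) > 1" and K: "rigid TYPE('n) (real N * d)" and N: "N > 0" and d: "d \<ge> 0"
  shows "rigid TYPE('n) d"
proof -
  define U :: "real ^ 'n" where "U = 0"
  obtain V where UV: "dist U V = d"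
    using vector_choose_dist[of d U] d by auto
  \<comment> \<open>The legs get integer length because such lengths are already rigid, so steps
    along them can be repeated.\<close>
  obtain m :: nat where m: "d \<le> real m" using real_arch_simple by blast
  then obtain Z where Z: "dist Z U = real m" "dist Z V = real m"
    using ex_isosceles[OF n, of U V "real m"] UV d by auto
  have "rigid TYPE('n) (norm (U - Z))" "rigid TYPE('n) (norm (V - Z))"
    using rigid_of_nat[OF n] Z by (simp_all add: dist_norm norm_minus_commute)
  note steps = this[THEN eventually_multiple_step[OF n, where X = Z and N = N]]
  have "dist (Z + real N *\<^sub>R (U - Z)) (Z + real N *\<^sub>R (V - Z)) = real N * d"
    using UV by (simp add: dist_norm flip: scaleR_diff_right)
  note big = rigidD[OF K this]
  have "eventually (\<lambda>f. dist (f U) (f V) = d) unit_filter"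
    using steps big
  proof eventually_elim
    case (elim f)
    have "f (Z + real N *\<^sub>R (U - Z)) - f (Z + real N *\<^sub>R (V - Z)) = real N *\<^sub>R (f U - f V)"
      using elim(1,2) by (simp only: diff_eq_eq) (simp add: scaleR_diff_right)
    then show ?case using elim(3) N by (simp add: dist_norm)
  qed
  then show ?thesis using UV by (rule rigidI)
qed

lemma rigid_Rats:
  assumes n: "CARD('n::finite) > 1" and q: "q \<in> \<rat>" "q \<ge> 0"
  shows "rigid TYPE('n) q"
proof -
  obtain m N :: nat where mN: "N \<noteq> 0" "\<bar>q\<bar> = real m / real N"
    using Rats_abs_nat_div_natE[OF q(1)] by blast
  then have "real N * q = real m" using q by (simp add: field_simps)
  then have "rigid TYPE('n) (real N * q)" using rigid_of_nat[OF n] by simp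
  then show ?thesis using rigid_divide[OF n, of N q] mN(1) q(2) by simp
qed

section \<open>Approximate preservation of arbitrary distances\<close>

lemma Rats_between_pos:
  assumes "x < (y :: real)" "x \<ge> 0"
  obtains q where "q \<in> \<rat>" "x < q" "q < y" "q > 0"
proof -
  obtain q where "q \<in> \<rat>" "x < q" "q < y" using Rats_dense_in_real[OF assms(1)] by blast
  with assms(2) that show ?thesis by auto
qed

text \<open>From above, X and Y are joined by two rational legs barely longer than half their
  distance. From below, the segment is prolonged to a rational length q, and the upper bound is
  applied to the short excess.\<close>

lemma tendsto_dist_unit_filter:
  fixes X Y :: "real ^ 'n"
  assumes n: "CARD('n) > 1"
  shows "((\<lambda>f. dist (f X) (f Y)) \<longlongrightarrow> dist X Y) unit_filter"
proof (rule tendstoI)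
  have upper: "eventually (\<lambda>f. dist (f X) (f Y) < dist X Y + e) unit_filter"
    if e: "e > 0" for e and X Y :: "real ^ 'n"
  proof -
    obtain q where q: "q \<in> \<rat>" "dist X Y / 2 < q" "q < dist X Y / 2 + e / 2" "q > 0"
      using Rats_between_pos[of "dist X Y / 2" "dist X Y / 2 + e / 2"] e by auto
    obtain Z where Z: "dist Z X = q" "dist Z Y = q"
      using ex_isosceles[OF n, of X Y q] q by auto
    have K: "rigid TYPE('n) q" using q by (intro rigid_Rats n) auto
    show ?thesis
      using rigidD[OF K Z(1)] rigidD[OF K Z(2)]
    proof eventually_elim
      case (elim f)
      have "dist (f X) (f Y) \<le> dist (f Z) (f X) + dist (f Z) (f Y)"
        by (metis dist_commute dist_triangle)
      then show ?case using elim q by (simp add: field_simps)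
    qed
  qed
  fix e :: real assume e: "e > 0"
  obtain q where q: "q \<in> \<rat>" "dist X Y < q" "q < dist X Y + e / 2" "q > 0"
    using Rats_between_pos[of "dist X Y" "dist X Y + e / 2"] e by auto
  have K: "rigid TYPE('n) q" using q by (intro rigid_Rats n) auto
  \<comment> \<open>Y' lies beyond Y on the ray from X, or in any direction if X = Y.\<close>
  have "\<exists>Y'. dist X Y' = q \<and> dist Y Y' = q - dist X Y"
  proof (cases "X = Y")
    case True
    obtain Y' where "dist X Y' = q" using vector_choose_dist[of q X] q by auto
    with True show ?thesis by auto
  next
    case False
    define Y' where "Y' = X + (q / dist X Y) *\<^sub>R (Y - X)"
    have "Y' - Y = (q / dist X Y - 1) *\<^sub>R (Y - X)" by (simp add: Y'_def algebra_simps)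
    moreover have "q / dist X Y - 1 > 0" using False q by simp
    ultimately have "norm (Y' - Y) = (q / dist X Y - 1) * dist X Y"
      by (simp add: dist_norm norm_minus_commute)
    also have "\<dots> = q - dist X Y" using False by (simp add: left_diff_distrib)
    finally have "dist Y Y' = q - dist X Y" by (simp add: dist_norm norm_minus_commute)
    moreover have "dist X Y' = q" using False q by (simp add: Y'_def dist_norm norm_minus_commute)
    ultimately show ?thesis by blast
  qed
  then obtain Y' where Y': "dist X Y' = q" "dist Y Y' = q - dist X Y" by blast
  have "eventually (\<lambda>f. dist (f Y) (f Y') < dist Y Y' + e / 2) unit_filter"
    using e by (intro upper) simp
  with upper[OF e, of X Y] rigidD[OF K Y'(1)]
  show "eventually (\<lambda>f. dist (dist (f X) (f Y)) (dist X Y) < e) unit_filter"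
  proof eventually_elim
    case (elim f)
    have "dist (f X) (f Y') \<le> dist (f X) (f Y) + dist (f Y) (f Y')" by (rule dist_triangle)
    then show ?case using elim e q Y' by (simp add: dist_real_def)
  qed
qed

text \<open>Polarization expresses the inner product by four squared distances.\<close>

lemma tendsto_inner_unit_filter:
  fixes A B C D :: "real ^ 'n"
  assumes n: "CARD('n) > 1"
  shows "((\<lambda>f. (f A - f C) \<bullet> (f B - f D)) \<longlongrightarrow> (A - C) \<bullet> (B - D)) unit_filter"
proof -
  have e: "(a - c) \<bullet> (b - d) = ((dist a d)\<^sup>2 + (dist c b)\<^sup>2 - (dist a b)\<^sup>2 - (dist c d)\<^sup>2) / 2"
    for a b c d :: "real ^ 'n"
    unfolding dist_norm power2_norm_eq_inner inner_diff_left inner_diff_right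
    by (simp add: inner_commute[of b a] inner_commute[of d a] inner_commute[of b c]
        inner_commute[of d c] algebra_simps)
  show ?thesis unfolding e
    by (intro tendsto_intros tendsto_dist_unit_filter n) auto
qed

section \<open>Midpoints along a coordinate axis\<close>

lemma ex_other_index:
  assumes "CARD('n::finite) > 1"
  shows "\<exists>j. j \<noteq> (k :: 'n)"
proof (rule ccontr)
  assume "\<not> ?thesis"
  then have "(UNIV :: 'n set) = {k}" by auto
  then have "CARD('n) = card {k}" by (simp only:)
  with assms show False by simp
qed

text \<open>The Gram determinant of the image vectors tends to that of the original orthogonal
  vectors, which is a product of nonzero squares. So it is eventually nonzero, and the image vectors
  are independent.\<close>

lemma eventually_independent:
  fixes A B :: "'n::finite \<Rightarrow> real ^ 'n"
  assumes n: "CARD('n) > 1"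
    and orth: "\<And>i j. i \<noteq> j \<Longrightarrow> (A i - B i) \<bullet> (A j - B j) = 0"
    and ne: "\<And>i. A i \<noteq> B i"
  shows "eventually (\<lambda>f. \<forall>w. (\<forall>i. w \<bullet> (f (A i) - f (B i)) = 0) \<longrightarrow> w = 0) unit_filter"
proof -
  define G where "G = (\<lambda>f :: real ^ 'n \<Rightarrow> real ^ 'n.
    \<chi> i j. (f (A i) - f (B i)) \<bullet> (f (A j) - f (B j)))"
  have "((\<lambda>f. det (G f)) \<longlongrightarrow> det (G id)) unit_filter"
    unfolding det_def G_def
    by (simp, intro tendsto_intros tendsto_inner_unit_filter n)
  moreover have "det (G id) = (\<Prod>i\<in>UNIV. G id $ i $ i)"
    by (rule det_diagonal) (simp add: G_def orth)
  then have "det (G id) \<noteq> 0" using ne by (simp add: G_def)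
  ultimately have "eventually (\<lambda>f. det (G f) \<noteq> 0) unit_filter"
    by (rule tendsto_imp_eventually_ne)
  then show ?thesis
  proof (eventually_elim, intro allI impI)
    fix f :: "real ^ 'n \<Rightarrow> real ^ 'n" and w :: "real ^ 'n"
    assume f: "det (G f) \<noteq> 0" and w: "\<forall>i. w \<bullet> (f (A i) - f (B i)) = 0"
    let ?q = "\<lambda>i. f (A i) - f (B i)"
    show "w = 0"
    proof (rule orthogonal_to_independent_family)
      fix c :: "real ^ 'n" assume c: "(\<Sum>i\<in>UNIV. (c $ i) *\<^sub>R ?q i) = 0"
      have "(G f *v c) $ i = ?q i \<bullet> (\<Sum>j\<in>UNIV. (c $ j) *\<^sub>R ?q j)" for i
        by (simp add: G_def matrix_vector_mult_def inner_sum_right mult.commute)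
      then have "(G f *v c) $ i = 0" for i unfolding c by simp
      then have "G f *v c = G f *v 0" by (simp add: vec_eq_iff[of "G f *v c"])
      moreover have "inj ((*v) (G f))" using f det_nz_iff_inj[of "(*v) (G f)"] by simp
      ultimately show "c = 0" by (elim injD)
    qed (use w in auto)
  qed
qed

lemma eventually_midpoint_Rats:
  fixes X Y :: "real ^ 'n"
  assumes n: "CARD('n) > 1" and q: "dist X Y \<in> \<rat>"
  shows "eventually (\<lambda>f. f ((1/2) *\<^sub>R (X + Y)) = (1/2) *\<^sub>R (f X + f Y)) unit_filter"
proof -
  define v where "v = (1/2) *\<^sub>R (Y - X)"
  have "norm v = dist X Y / 2" by (simp add: v_def dist_norm norm_minus_commute)
  then have "norm v \<in> \<rat>" using q by (simp only: Rats_divide Rats_number_of)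
  then have "rigid TYPE('n) (norm v)" by (intro rigid_Rats n) auto
  moreover have "X + 2 *\<^sub>R v = Y" "X + v = (1/2) *\<^sub>R (X + Y)"
    by (simp_all add: v_def vec_eq_iff field_simps)
  ultimately have "eventually (\<lambda>f. f Y - f ((1/2) *\<^sub>R (X + Y)) = f ((1/2) *\<^sub>R (X + Y)) - f X) unit_filter"
    using eventually_double_step[OF n, of v X] by simp
  then show ?thesis
    by eventually_elim (simp add: vec_eq_iff field_simps)
qed

text \<open>The midpoint M of XY has rational distances to the midpoints of XZ and YZ, even if XY is
  irrational. For the defect w this gives |w + b/2| = |b|/2, that is w.w + w.b = 0, with b the image
  of the vector from Z to Y or from Z to X.\<close>

lemma eventually_midpoint_defect:
  fixes X Y Z :: "real ^ 'n"
  assumes n: "CARD('n) > 1" and q: "dist X Z \<in> \<rat>" "dist Y Z \<in> \<rat>"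
  shows "eventually (\<lambda>f. let w = f ((1/2) *\<^sub>R (X + Y)) - (1/2) *\<^sub>R (f X + f Y) in
    w \<bullet> (f X - f Y) = 0 \<and> w \<bullet> w = w \<bullet> (f Z - f Y)) unit_filter"
proof -
  define M where "M = (1/2) *\<^sub>R (X + Y)"
  have halves: "norm (M - (1/2) *\<^sub>R (X + Z)) = dist Y Z / 2" "norm (M - (1/2) *\<^sub>R (Y + Z)) = dist X Z / 2"
    unfolding M_def by (simp_all flip: scaleR_diff_right add: dist_norm)
  have K: "rigid TYPE('n) (dist X Z)" "rigid TYPE('n) (dist Y Z)"
    "rigid TYPE('n) (dist X Z / 2)" "rigid TYPE('n) (dist Y Z / 2)"
    using q by (auto intro!: rigid_Rats n)
  have D: "dist M ((1/2) *\<^sub>R (X + Z)) = dist Y Z / 2" "dist M ((1/2) *\<^sub>R (Y + Z)) = dist X Z / 2"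
    unfolding dist_norm[of M] using halves by simp_all
  show ?thesis
    using eventually_midpoint_Rats[OF n q(1)] eventually_midpoint_Rats[OF n q(2)]
      rigidD[OF K(1) refl] rigidD[OF K(2) refl] rigidD[OF K(4) D(1)] rigidD[OF K(3) D(2)]
  proof eventually_elim
    case (elim f)
    define w where "w = f M - (1/2) *\<^sub>R (f X + f Y)"
    have expand: "w \<bullet> w + w \<bullet> b = 0" if "norm (w + (1/2) *\<^sub>R b) = norm b / 2" for b
    proof -
      have "(norm (w + (1/2) *\<^sub>R b))\<^sup>2 = (norm b / 2)\<^sup>2" using that by simp
      then show ?thesis
        by (simp add: power2_norm_eq_inner power_divide inner_add_left inner_add_right inner_commute field_simps)
    qed
    have "w + (1/2) *\<^sub>R (f Y - f Z) = f M - f ((1/2) *\<^sub>R (X + Z))"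
      "w + (1/2) *\<^sub>R (f X - f Z) = f M - f ((1/2) *\<^sub>R (Y + Z))"
      unfolding elim(1,2) by (simp_all add: w_def vec_eq_iff field_simps)
    then have "norm (w + (1/2) *\<^sub>R (f Y - f Z)) = norm (f Y - f Z) / 2"
      "norm (w + (1/2) *\<^sub>R (f X - f Z)) = norm (f X - f Z) / 2"
      using elim(3-6) by (simp_all add: dist_norm)
    then have "w \<bullet> w + w \<bullet> (f Y - f Z) = 0" "w \<bullet> w + w \<bullet> (f X - f Z) = 0"
      by (blast intro: expand)+
    then show ?case
      unfolding Let_def M_def[symmetric] w_def[symmetric] by (simp add: inner_diff_right)
  qed
qed

lemma dist_axes:
  fixes M :: "real ^ 'n"
  assumes "i \<noteq> j"
  shows "dist (M + s *\<^sub>R axis i 1) (M + t *\<^sub>R axis j 1) = sqrt (s\<^sup>2 + t\<^sup>2)"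
proof -
  have "(norm (s *\<^sub>R axis i 1 - t *\<^sub>R axis j 1 :: real ^ 'n))\<^sup>2 = s\<^sup>2 + t\<^sup>2"
    unfolding power2_norm_eq_inner using assms
    by (simp add: inner_diff_left inner_diff_right inner_axis_axis power2_eq_square)
  then show ?thesis by (simp add: dist_norm real_sqrt_unique)
qed

text \<open>The points M +- c_i e_i form a cross-polytope whose edges at the two k-axis vertices
  have rational length r. Taking the other vertices as Z in the defect lemma makes w orthogonal to
  the images of all n diagonals, which are independent, so w = 0.\<close>

lemma eventually_midpoint_axis:
  fixes M :: "real ^ 'n" and k :: 'n
  assumes n: "CARD('n) > 1"
  shows "eventually (\<lambda>f. f M = (1/2) *\<^sub>R (f (M + h *\<^sub>R axis k 1) + f (M - h *\<^sub>R axis k 1))) unit_filter"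
proof (cases "h = 0")
  case True
  then show ?thesis by (simp add: vec_eq_iff)
next
  case False
  obtain r where r: "r \<in> \<rat>" "\<bar>h\<bar> < r" "r > 0"
    using Rats_between_pos[of "\<bar>h\<bar>" "\<bar>h\<bar> + 1"] by auto
  define l where "l = sqrt (r\<^sup>2 - h\<^sup>2)"
  have hr: "h\<^sup>2 < r\<^sup>2" using r by (metis abs_ge_zero power2_abs power_strict_mono zero_less_numeral)
  then have l: "l > 0" "h\<^sup>2 + l\<^sup>2 = r\<^sup>2" by (simp_all add: l_def)
  define c where "c = (\<lambda>i. if i = k then h else l)"
  define A where "A = (\<lambda>i. M + c i *\<^sub>R axis i 1)"
  define B where "B = (\<lambda>i. M - c i *\<^sub>R axis i 1)"
  have c0: "c i \<noteq> 0" for i using False l by (simp add: c_def)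
  have AB: "A i - B i = (2 * c i) *\<^sub>R axis i 1" for i by (simp add: A_def B_def vec_eq_iff)
  have mid: "(1/2) *\<^sub>R (A k + B k) = M" by (simp add: A_def B_def vec_eq_iff)
  have d: "dist (A k) (A i) = r" "dist (A k) (B i) = r" "dist (B k) (A i) = r" "dist (B k) (B i) = r"
    if "i \<noteq> k" for i
    using that dist_axes[of k i M h l] dist_axes[of k i M h "- l"] dist_axes[of k i M "- h" l]
      dist_axes[of k i M "- h" "- l"] l r
    by (simp_all add: A_def B_def c_def)
  have "eventually (\<lambda>f. \<forall>i. let w = f M - (1/2) *\<^sub>R (f (A k) + f (B k)) in
      w \<bullet> (f (A i) - f (B i)) = 0) unit_filter"
  proof (rule eventually_all_finite)
    fix i
    show "eventually (\<lambda>f. let w = f M - (1/2) *\<^sub>R (f (A k) + f (B k)) in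
      w \<bullet> (f (A i) - f (B i)) = 0) unit_filter"
    proof (cases "i = k")
      case False
      have "eventually (\<lambda>f. let w = f M - (1/2) *\<^sub>R (f (A k) + f (B k)) in
          w \<bullet> (f (A k) - f (B k)) = 0 \<and> w \<bullet> w = w \<bullet> (f (C i) - f (B k))) unit_filter"
        if "C = A \<or> C = B" for C
        using eventually_midpoint_defect[OF n, of "A k" "C i" "B k"] that d[OF False] r(1)
        unfolding mid by auto
      note defect = this[unfolded Let_def]
      \<comment> \<open>The value of w.w obtained with Z = A i and with Z = B i is the same;
        subtracting leaves orthogonality to the diagonal.\<close>
      have "eventually (\<lambda>f. (f M - (1/2) *\<^sub>R (f (A k) + f (B k))) \<bullet> (f (A i) - f (B i)) = 0) unit_filter"
        using defect[OF disjI1[OF refl]] defect[OF disjI2[OF refl]]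
      proof eventually_elim
        case (elim f)
        have "v \<bullet> (b - c) = 0" if "v \<bullet> v = v \<bullet> (b - a)" "v \<bullet> v = v \<bullet> (c - a)" for v a b c :: "real ^ 'n"
          using that by (simp add: inner_diff_right)
        from this[OF conjunct2[OF elim(1)] conjunct2[OF elim(2)]] show ?case .
      qed
      then show ?thesis unfolding Let_def .
    next
      case True
      \<comment> \<open>For the k-diagonal itself any vertex on another axis serves as Z.\<close>
      obtain j where j: "j \<noteq> k" using ex_other_index[OF n] by blast
      show ?thesis
        using eventually_midpoint_defect[OF n, of "A k" "A j" "B k"] d[OF j] r(1)
        unfolding mid Let_def True by (auto elim: eventually_mono)
    qed
  qed
  moreover have "eventually (\<lambda>f. \<forall>w. (\<forall>i. w \<bullet> (f (A i) - f (B i)) = 0) \<longrightarrow> w = 0) unit_filter"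
  proof (rule eventually_independent[OF n])
    show "(A i - B i) \<bullet> (A j - B j) = 0" if "i \<noteq> j" for i j
      using that by (simp add: AB inner_axis_axis)
    show "A i \<noteq> B i" for i
    proof -
      have "A i - B i \<noteq> 0" unfolding AB using c0 by (simp add: axis_eq_0_iff)
      then show ?thesis by simp
    qed
  qed
  ultimately have "eventually (\<lambda>f. f M - (1/2) *\<^sub>R (f (A k) + f (B k)) = 0) unit_filter"
    unfolding Let_def by eventually_elim blast
  then show ?thesis by eventually_elim (simp add: A_def B_def c_def)
qed

section \<open>Additivity of displacements along an axis\<close>

definition axis_displacement :: "'n \<Rightarrow> (real ^ 'n \<Rightarrow> real ^ 'n) \<Rightarrow> real \<Rightarrow> real ^ 'n" where
  "axis_displacement k f s = f (s *\<^sub>R axis k 1) - f 0"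

lemma axis_displacement_0 [simp]: "axis_displacement k f 0 = 0"
  by (simp add: axis_displacement_def)

text \<open>On the axis, the pair s, t and the pair 0, s + t have the same midpoint (s +
  t)/2.\<close>

lemma eventually_displacement_add:
  fixes k :: "'n::finite"
  assumes n: "CARD('n) > 1"
  shows "eventually (\<lambda>f. axis_displacement k f (s + t) = axis_displacement k f s + axis_displacement k f t)
    unit_filter"
proof -
  let ?e = "axis k 1 :: real ^ 'n"
  have h: "(s + t) / 2 + (s - t) / 2 = s" "(s + t) / 2 - (s - t) / 2 = t" "(s + t) / 2 + (s + t) / 2 = s + t"
    by (simp_all add: field_simps)
  have e: "((s + t) / 2) *\<^sub>R ?e + ((s - t) / 2) *\<^sub>R ?e = s *\<^sub>R ?e"
    "((s + t) / 2) *\<^sub>R ?e - ((s - t) / 2) *\<^sub>R ?e = t *\<^sub>R ?e"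
    "((s + t) / 2) *\<^sub>R ?e + ((s + t) / 2) *\<^sub>R ?e = (s + t) *\<^sub>R ?e"
    by (simp_all only: scaleR_add_left[symmetric] scaleR_diff_left[symmetric] h)
  show ?thesis
    using eventually_midpoint_axis[OF n, of "((s + t) / 2) *\<^sub>R ?e" "(s - t) / 2" k]
      eventually_midpoint_axis[OF n, of "((s + t) / 2) *\<^sub>R ?e" "(s + t) / 2" k]
    unfolding e
  proof eventually_elim
    case (elim f)
    have "(1/2) *\<^sub>R (f (s *\<^sub>R ?e) + f (t *\<^sub>R ?e)) = (1/2) *\<^sub>R (f ((s + t) *\<^sub>R ?e) + f 0)"
      using elim by simp
    then have "f (s *\<^sub>R ?e) + f (t *\<^sub>R ?e) = f ((s + t) *\<^sub>R ?e) + f 0"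
      by (simp del: scaleR_add_right)
    then show ?case by (simp add: axis_displacement_def algebra_simps)
  qed
qed

lemma eventually_displacement_minus:
  fixes k :: "'n::finite"
  assumes n: "CARD('n) > 1"
  shows "eventually (\<lambda>f. axis_displacement k f (- s) = - axis_displacement k f s) unit_filter"
  using eventually_displacement_add[OF n, of k s "- s"]
  by eventually_elim (simp add: eq_neg_iff_add_eq_0 add.commute)

section \<open>Inversion and multiplicativity on an axis\<close>

text \<open>The side lengths of the inversor: t + 1/t and t - 1/t for a large rational t, since
  their squares differ by 4.\<close>

lemma ex_Rats_pythagorean:
  obtains c d :: real where "c \<in> \<rat>" "d \<in> \<rat>" "c > 0" "d > 0" "c\<^sup>2 - d\<^sup>2 = 4" "b < c"
proof -
  obtain t where t: "t \<in> \<rat>" "max 1 b < t"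
    using Rats_dense_in_real[of "max 1 b" "max 1 b + 1"] by auto
  then have t0: "t > 1" "b < t" by auto
  then have "1 / t < 1" "1 / t > 0" by (simp_all add: field_simps)
  show ?thesis
  proof (rule that[of "t + 1 / t" "t - 1 / t"])
    show "(t + 1 / t)\<^sup>2 - (t - 1 / t)\<^sup>2 = 4" using t0 by (simp add: power2_eq_square field_simps)
    show "b < t + 1 / t" "t + 1 / t > 0" "t - 1 / t > 0"
      using t0 \<open>1 / t < 1\<close> \<open>1 / t > 0\<close> by linarith+
  qed (use t in auto)
qed

text \<open>Peaucellier's inversor: the points at \<open>s + 1/s\<close> and \<open>s - 1/s\<close> on the axis have rational
  distances \<open>c\<close> and \<open>d\<close> to the same points \<open>\<plusminus>l\<close> on every other axis.\<close>

lemma eventually_displacement_inverse: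
  fixes k :: "'n::finite"
  assumes n: "CARD('n) > 1" and s: "s \<noteq> 0"
  shows "eventually (\<lambda>f. axis_displacement k f s \<noteq> 0 \<and>
    axis_displacement k f (1 / s) =
      (1 / (axis_displacement k f s \<bullet> axis_displacement k f s)) *\<^sub>R axis_displacement k f s) unit_filter"
proof -
  define m where "m = s + 1 / s"
  define w where "w = s + - (1 / s)"
  have mw: "m\<^sup>2 - w\<^sup>2 = 4" using s by (simp add: m_def w_def power2_eq_square field_simps)
  obtain c d where cd: "c \<in> \<rat>" "d \<in> \<rat>" "c > 0" "d > 0" "c\<^sup>2 - d\<^sup>2 = 4" "\<bar>m\<bar> < c"
    using ex_Rats_pythagorean by metis
  have "m\<^sup>2 < c\<^sup>2" using cd by (metis abs_ge_zero power2_abs power_strict_mono zero_less_numeral)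
  \<comment> \<open>One height l suits both side lengths, because c^2 - d^2 = m^2 - w^2 = 4.\<close>
  define l where "l = sqrt (c\<^sup>2 - m\<^sup>2)"
  have l: "l > 0" "m\<^sup>2 + l\<^sup>2 = c\<^sup>2" using \<open>m\<^sup>2 < c\<^sup>2\<close> by (simp_all add: l_def)
  then have l': "w\<^sup>2 + l\<^sup>2 = d\<^sup>2" using mw cd by simp
  \<comment> \<open>The entry at k merely completes the family to n independent directions.\<close>
  define A where "A = (\<lambda>i. (if i = k then 1 else l) *\<^sub>R axis i 1 :: real ^ 'n)"
  define H where "H = axis_displacement k"
  have D: "dist (m *\<^sub>R axis k 1) (l *\<^sub>R axis j 1 :: real ^ 'n) = c"
    "dist (m *\<^sub>R axis k 1) (- l *\<^sub>R axis j 1 :: real ^ 'n) = c"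
    "dist (w *\<^sub>R axis k 1) (l *\<^sub>R axis j 1 :: real ^ 'n) = d"
    "dist (w *\<^sub>R axis k 1) (- l *\<^sub>R axis j 1 :: real ^ 'n) = d" if "j \<noteq> k" for j
    using that dist_axes[of k j 0 m l] dist_axes[of k j 0 m "- l"] dist_axes[of k j 0 w l]
      dist_axes[of k j 0 w "- l"] l l' cd by simp_all
  have K: "rigid TYPE('n) c" "rigid TYPE('n) d" using cd by (auto intro!: rigid_Rats n)
  have orth: "u \<bullet> v = 0 \<and> u \<bullet> u + v \<bullet> v = r\<^sup>2" if "norm (u - v) = r" "norm (u - - v) = r"
    for u v :: "real ^ 'n" and r
  proof -
    have "(u - v) \<bullet> (u - v) = r\<^sup>2" "(u - - v) \<bullet> (u - - v) = r\<^sup>2"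
      using that by (metis power2_norm_eq_inner)+
    then show ?thesis by (simp add: algebra_simps inner_commute)
  qed
  have "eventually (\<lambda>f. \<forall>j. j \<noteq> k \<longrightarrow>
      H f m \<bullet> (f (A j) - f 0) = 0 \<and> H f w \<bullet> (f (A j) - f 0) = 0 \<and>
      H f m \<bullet> H f m - H f w \<bullet> H f w = 4) unit_filter"
  proof (rule eventually_all_finite)
    fix j
    show "eventually (\<lambda>f. j \<noteq> k \<longrightarrow>
      H f m \<bullet> (f (A j) - f 0) = 0 \<and> H f w \<bullet> (f (A j) - f 0) = 0 \<and>
      H f m \<bullet> H f m - H f w \<bullet> H f w = 4) unit_filter"
    proof (cases "j = k")
      case False
      show ?thesis
        using rigidD[OF K(1) D(1)[OF False]] rigidD[OF K(1) D(2)[OF False]]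
          rigidD[OF K(2) D(3)[OF False]] rigidD[OF K(2) D(4)[OF False]]
          eventually_displacement_minus[OF n, of j l]
      proof eventually_elim
        case (elim f)
        define Q where "Q = f (A j) - f 0"
        have Q: "f (l *\<^sub>R axis j 1) = Q + f 0" using False by (simp add: Q_def A_def)
        have Q': "f (- l *\<^sub>R axis j 1) = - Q + f 0"
          using elim(5) unfolding axis_displacement_def Q by (simp add: algebra_simps)
        have "norm (H f m - Q) = c" "norm (H f m - - Q) = c"
          "norm (H f w - Q) = d" "norm (H f w - - Q) = d"
          using elim(1-4) unfolding Q Q' by (simp_all add: H_def axis_displacement_def dist_norm algebra_simps)
        with orth[of "H f m" Q c] orth[of "H f w" Q d] cd(5) show ?case
          unfolding Q_def[symmetric] by auto
      qed
    qed simp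
  qed
  moreover have "eventually (\<lambda>f. \<forall>v. (\<forall>i. v \<bullet> (f (A i) - f 0) = 0) \<longrightarrow> v = 0) unit_filter"
  proof (rule eventually_independent[OF n])
    show "(A i - 0) \<bullet> (A j - 0) = 0" if "i \<noteq> j" for i j
      using that by (simp add: A_def inner_axis_axis)
    show "A i \<noteq> 0" for i using l by (simp add: A_def axis_eq_0_iff)
  qed
  moreover have "eventually (\<lambda>f. H f m = H f s + H f (1 / s)) unit_filter"
    unfolding H_def m_def by (rule eventually_displacement_add[OF n])
  moreover have "eventually (\<lambda>f. H f w = H f s - H f (1 / s)) unit_filter"
    using eventually_displacement_add[OF n, of k s "- (1 / s)"] eventually_displacement_minus[OF n, of k "1 / s"]
    unfolding H_def w_def by eventually_elim simp
  ultimately have "eventually (\<lambda>f. H f s \<noteq> 0 \<and> H f (1 / s) = (1 / (H f s \<bullet> H f s)) *\<^sub>R H f s) unit_filter"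
  proof eventually_elim
    case (elim f)
    let ?P = "H f s" and ?R = "H f (1 / s)" and ?V = "\<lambda>i. f (A i) - f 0"
    obtain j where j: "j \<noteq> k" using ex_other_index[OF n] by blast
    \<comment> \<open>|P + R|^2 - |P - R|^2 = 4 is four times the inner product.\<close>
    have PR: "?P \<bullet> ?R = 1"
      using elim(1)[rule_format, OF j] unfolding elim(3,4)
      by (simp add: inner_add_left inner_add_right inner_diff_left inner_diff_right inner_commute)
    then have P0: "?P \<noteq> 0" by auto
    have PV: "?P \<bullet> ?V i = 0" and RV: "?R \<bullet> ?V i = 0" if "i \<noteq> k" for i
    proof -
      have "(?P + ?R) \<bullet> ?V i = 0" "(?P - ?R) \<bullet> ?V i = 0"
        using elim(1)[rule_format, OF that] unfolding elim(3,4) by auto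
      then show "?P \<bullet> ?V i = 0" "?R \<bullet> ?V i = 0"
        by (simp_all only: inner_add_left inner_diff_left)
    qed
    define p where "p = ?P \<bullet> ?V k"
    define r where "r = ?R \<bullet> ?V k"
    have p0: "p \<noteq> 0"
    proof
      assume "p = 0"
      then have "?P \<bullet> ?V i = 0" for i using PV[of i] by (cases "i = k") (auto simp: p_def)
      then show False using elim(2) P0 by blast
    qed
    \<comment> \<open>P and R are orthogonal to every direction except the k-th, and this
      combination cancels there too. So it vanishes, and R is a multiple of P.\<close>
    have "(p *\<^sub>R ?R - r *\<^sub>R ?P) \<bullet> ?V i = 0" for i
    proof (cases "i = k")
      case True
      then show ?thesis unfolding inner_diff_left inner_scaleR_left by (simp only: p_def r_def mult.commute diff_self)
    next
      case False
      then show ?thesis unfolding inner_diff_left inner_scaleR_left by (simp add: PV RV)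
    qed
    then have pr: "p *\<^sub>R ?R = r *\<^sub>R ?P" using elim(2) by (metis right_minus_eq)
    then have R: "?R = (r / p) *\<^sub>R ?P" using p0
      by (metis divide_inverse_commute scaleR_scaleR left_inverse scaleR_one)
    then have "(r / p) * (?P \<bullet> ?P) = 1" using PR by (metis inner_scaleR_right)
    then have "r / p = 1 / (?P \<bullet> ?P)" using P0 by (intro nonzero_eq_divide_eq[THEN iffD2]) auto
    with P0 R show ?case by simp
  qed
  then show ?thesis unfolding H_def .
qed

section \<open>The axis coordinate respects sums, inverses and products\<close>

definition axis_coordinate :: "'n \<Rightarrow> (real ^ 'n \<Rightarrow> real ^ 'n) \<Rightarrow> real \<Rightarrow> real" where
  "axis_coordinate k f s = axis_displacement k f s \<bullet> axis_displacement k f 1"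

lemma eventually_displacement_unit:
  fixes k :: "'n::finite"
  shows "eventually (\<lambda>f. axis_displacement k f 1 \<bullet> axis_displacement k f 1 = 1) unit_filter"
proof -
  have "eventually (\<lambda>f. dist (f (1 *\<^sub>R axis k 1)) (f 0) = 1) unit_filter"
    by (intro rigidD rigid_1) (simp add: dist_norm)
  then show ?thesis
    by eventually_elim (simp add: axis_displacement_def dist_norm flip: power2_norm_eq_inner)
qed

text \<open>The vector form of \<open>1 / (1 - 1/s) = 1 + 1 / (s - 1)\<close> holds only on the line through \<open>E\<close>.\<close>

lemma inversion_shift_imp_parallel:
  fixes P E :: "'a::real_inner"
  assumes E: "E \<bullet> E = 1" and P: "P \<noteq> 0" "P \<noteq> E"
    and F: "F = E - (1 / (P \<bullet> P)) *\<^sub>R P"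
    and eq: "(1 / (F \<bullet> F)) *\<^sub>R F = E + (1 / ((P - E) \<bullet> (P - E))) *\<^sub>R (P - E)"
  shows "P = (P \<bullet> E) *\<^sub>R E"
proof -
  define u where "u = P \<bullet> P"
  define p where "p = P \<bullet> E"
  define v where "v = (P - E) \<bullet> (P - E)"
  have u0: "u \<noteq> 0" and v0: "v \<noteq> 0" using P by (simp_all add: u_def v_def)
  have v: "v = u - 2 * p + 1"
    by (simp add: v_def u_def p_def E inner_diff_left inner_diff_right inner_commute)
  have "F \<bullet> F = v / u"
  proof -
    have "F \<bullet> F = 1 - 2 * p / u + (1 / u) * (1 / u) * u"
      unfolding F by (simp add: inner_diff_left inner_diff_right inner_commute[of E P] E diff_divide_distrib
          flip: u_def p_def)
    then show ?thesis using u0 by (simp add: v diff_divide_distrib add_divide_distrib)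
  qed
  then have "(u / v) *\<^sub>R (E - (1 / u) *\<^sub>R P) = E + (1 / v) *\<^sub>R (P - E)"
    using eq by (simp add: F flip: u_def v_def)
  \<comment> \<open>Since |F|^2 = v/u, clearing denominators leaves a linear equation whose solution
    is P = p E.\<close>
  then have "v *\<^sub>R ((u / v) *\<^sub>R (E - (1 / u) *\<^sub>R P)) = v *\<^sub>R (E + (1 / v) *\<^sub>R (P - E))" by simp
  then have "u *\<^sub>R E - P = v *\<^sub>R E + (P - E)"
    using u0 v0 by (simp add: scaleR_diff_right scaleR_add_right)
  then have "2 *\<^sub>R P = (u - v + 1) *\<^sub>R E" by (simp add: algebra_simps scaleR_2)
  then have "2 *\<^sub>R P = 2 *\<^sub>R (p *\<^sub>R E)" by (simp add: v)
  then have "P = p *\<^sub>R E" by (simp only: scaleR_cancel_left) simp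
  then show ?thesis unfolding p_def .
qed

text \<open>Inversion at s, s - 1 and 1 - 1/s together with additivity produces the hypotheses of
  the preceding lemma for P = H(s), E = H(1), F = H(1 - 1/s). The values 0 and 1, where these
  inverses break down, are treated directly.\<close>

lemma eventually_displacement_line:
  fixes k :: "'n::finite"
  assumes n: "CARD('n) > 1"
  shows "eventually (\<lambda>f. axis_displacement k f s = axis_coordinate k f s *\<^sub>R axis_displacement k f 1) unit_filter"
proof -
  consider "s = 0" | "s = 1" | "s \<noteq> 0" "s \<noteq> 1" by blast
  then show ?thesis
  proof cases
    case 1
    then show ?thesis by (simp add: axis_coordinate_def)
  next
    case 2
    show ?thesis
      using eventually_displacement_unit[of k] unfolding 2
      by eventually_elim (simp add: axis_coordinate_def)
  next
    case 3
    have s1: "s - 1 \<noteq> 0" "1 - 1 / s \<noteq> 0" using 3 by auto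
    have e: "1 / (1 - 1 / s) = 1 + 1 / (s - 1)" "1 + (s - 1) = s" "1 / s + (1 - 1 / s) = 1"
      using 3 by (auto simp: field_simps)
    show ?thesis
      using eventually_displacement_unit[of k]
        eventually_displacement_inverse[OF n 3(1), of k] eventually_displacement_inverse[OF n s1(1), of k]
        eventually_displacement_inverse[OF n s1(2), of k]
        eventually_displacement_add[OF n, of k 1 "s - 1"]
        eventually_displacement_add[OF n, of k "1 / s" "1 - 1 / s"]
        eventually_displacement_add[OF n, of k 1 "1 / (s - 1)"]
      unfolding e
    proof eventually_elim
      case (elim f)
      let ?H = "axis_displacement k f"
      have S: "?H (s - 1) = ?H s - ?H 1" and F: "?H (1 - 1 / s) = ?H 1 - ?H (1 / s)"
        using elim(5,6) by (simp_all add: algebra_simps)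
      have "?H (1 - 1 / s) = ?H 1 - (1 / (?H s \<bullet> ?H s)) *\<^sub>R ?H s"
        using F elim(2) by metis
      moreover have "(1 / (?H (1 - 1 / s) \<bullet> ?H (1 - 1 / s))) *\<^sub>R ?H (1 - 1 / s)
          = ?H 1 + (1 / ((?H s - ?H 1) \<bullet> (?H s - ?H 1))) *\<^sub>R (?H s - ?H 1)"
        using elim(3,4,7) unfolding S by metis
      moreover have "?H s \<noteq> 0" "?H s \<noteq> ?H 1" using elim(2,3) S by auto
      ultimately show ?case
        unfolding axis_coordinate_def using inversion_shift_imp_parallel[OF elim(1)] by blast
    qed
  qed
qed

lemma eventually_coordinate_1:
  fixes k :: "'n::finite"
  shows "eventually (\<lambda>f. axis_coordinate k f 1 = 1) unit_filter"
  using eventually_displacement_unit[of k] by (simp add: axis_coordinate_def)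

lemma axis_coordinate_0 [simp]: "axis_coordinate k f 0 = 0"
  by (simp add: axis_coordinate_def)

lemma eventually_coordinate_add:
  fixes k :: "'n::finite"
  assumes n: "CARD('n) > 1"
  shows "eventually (\<lambda>f. axis_coordinate k f (s + t) = axis_coordinate k f s + axis_coordinate k f t) unit_filter"
  using eventually_displacement_add[OF n, of k s t]
  by eventually_elim (simp add: axis_coordinate_def inner_add_left)

lemma eventually_coordinate_minus:
  fixes k :: "'n::finite"
  assumes n: "CARD('n) > 1"
  shows "eventually (\<lambda>f. axis_coordinate k f (- s) = - axis_coordinate k f s) unit_filter"
  using eventually_displacement_minus[OF n, of k s]
  by eventually_elim (simp add: axis_coordinate_def)

lemma eventually_coordinate_inverse:
  fixes k :: "'n::finite"
  assumes n: "CARD('n) > 1" and s: "s \<noteq> 0"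
  shows "eventually (\<lambda>f. axis_coordinate k f s \<noteq> 0 \<and>
    axis_coordinate k f (1 / s) = 1 / axis_coordinate k f s) unit_filter"
  using eventually_displacement_inverse[OF n s, of k] eventually_displacement_line[OF n, of k s]
    eventually_displacement_unit[of k]
proof eventually_elim
  case (elim f)
  let ?H = "axis_displacement k f" and ?g = "axis_coordinate k f s"
  have g0: "?g \<noteq> 0" using elim(1,2) by auto
  have "?H s \<bullet> ?H s = ?g * ?g" by (subst (1 2) elim(2)) (simp add: elim(3))
  moreover have "axis_coordinate k f (1 / s) = (1 / (?H s \<bullet> ?H s)) * ?g"
    using elim(1) by (simp add: axis_coordinate_def)
  ultimately show ?case using g0 by simp
qed

text \<open>As in Hua's identity, 1/(s + 1) + 1/(s^2 + s) = 1/s expresses the square through sums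
  and inverses alone.\<close>

lemma eventually_coordinate_square:
  fixes k :: "'n::finite"
  assumes n: "CARD('n) > 1"
  shows "eventually (\<lambda>f. axis_coordinate k f (s * s) = axis_coordinate k f s * axis_coordinate k f s) unit_filter"
proof -
  consider "s = 0" | "s = - 1" | "s \<noteq> 0" "s + 1 \<noteq> 0" by (metis add_eq_0_iff2)
  then show ?thesis
  proof cases
    case 1
    then show ?thesis by simp
  next
    case 2
    show ?thesis
      using eventually_coordinate_minus[OF n, of k 1] eventually_coordinate_1[of k] unfolding 2
      by eventually_elim simp
  next
    case 3
    have s2: "s * s + s \<noteq> 0" using 3 by (metis distrib_left mult.right_neutral mult_eq_0_iff)
    have "1 / (s + 1) + 1 / (s * (s + 1)) = 1 / s"
      using 3 by (simp add: divide_simps)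
    then have e: "1 / (s + 1) + 1 / (s * s + s) = 1 / s" by (simp add: distrib_left)
    show ?thesis
      using eventually_coordinate_inverse[OF n 3(1), of k] eventually_coordinate_inverse[OF n 3(2), of k]
        eventually_coordinate_inverse[OF n s2, of k]
        eventually_coordinate_add[OF n, of k "1 / (s + 1)" "1 / (s * s + s)"]
        eventually_coordinate_add[OF n, of k s 1] eventually_coordinate_add[OF n, of k "s * s" s]
        eventually_coordinate_1[of k]
      unfolding e
    proof eventually_elim
      case (elim f)
      let ?g = "axis_coordinate k f"
      have "1 / ?g s = 1 / (?g s + 1) + 1 / ?g (s * s + s)" using elim by simp
      moreover have "?g s \<noteq> 0" "?g s + 1 \<noteq> 0" "?g (s * s + s) \<noteq> 0" using elim by auto
      ultimately have "?g (s * s + s) = ?g s * ?g s + ?g s" by (simp add: field_simps)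
      then show ?case using elim(6) by simp
    qed
  qed
qed

lemma eventually_coordinate_mult:
  fixes k :: "'n::finite"
  assumes n: "CARD('n) > 1"
  shows "eventually (\<lambda>f. axis_coordinate k f (s * t) = axis_coordinate k f s * axis_coordinate k f t) unit_filter"
proof -
  have e: "(s + t) * (s + t) = (s * s + t * t) + (s * t + s * t)" by (simp add: algebra_simps)
  show ?thesis
    using eventually_coordinate_square[OF n, of k "s + t"] eventually_coordinate_square[OF n, of k s]
      eventually_coordinate_square[OF n, of k t] eventually_coordinate_add[OF n, of k s t]
      eventually_coordinate_add[OF n, of k "s * s + t * t" "s * t + s * t"]
      eventually_coordinate_add[OF n, of k "s * s" "t * t"] eventually_coordinate_add[OF n, of k "s * t" "s * t"]
    unfolding e by eventually_elim (simp add: algebra_simps)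
qed

lemma eventually_coordinate_Ints:
  fixes k :: "'n::finite"
  assumes n: "CARD('n) > 1" and c: "c \<in> \<int>"
  shows "eventually (\<lambda>f. axis_coordinate k f c = c) unit_filter"
proof -
  have nat: "eventually (\<lambda>f. axis_coordinate k f (real m) = real m) unit_filter" for m
  proof (induction m)
    case (Suc m)
    then show ?case
      using eventually_coordinate_add[OF n, of k "real m" 1] eventually_coordinate_1[of k]
      by eventually_elim (simp add: add.commute)
  qed simp
  obtain z where "c = of_int z" using c Ints_cases by blast
  then consider m where "c = real m" | m where "c = - real m"
    by (metis int_cases2 of_int_minus of_int_of_nat_eq)
  then show ?thesis
  proof cases
    case (2 m)
    show ?thesis
      using nat[of m] eventually_coordinate_minus[OF n, of k "real m"] unfolding 2
      by eventually_elim simp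
  qed (use nat in simp)
qed

text \<open>Horner's scheme uses finitely many sums and products, so finitely many forced identities
  suffice.\<close>

lemma eventually_coordinate_poly:
  fixes k :: "'n::finite"
  assumes n: "CARD('n) > 1" and "\<And>i. coeff p i \<in> \<int>"
  shows "eventually (\<lambda>f. axis_coordinate k f (poly p s) = poly p (axis_coordinate k f s)) unit_filter"
  using assms(2)
proof (induction p)
  case (pCons a p)
  have a: "a \<in> \<int>" using pCons.prems[of 0] by simp
  have "coeff p i \<in> \<int>" for i using pCons.prems[of "Suc i"] by simp
  note pCons.IH[OF this]
  then show ?case
    using eventually_coordinate_Ints[OF n a, of k] eventually_coordinate_add[OF n, of k a "s * poly p s"]
      eventually_coordinate_mult[OF n, of k s "poly p s"]
    by eventually_elim simp
qed simp

section \<open>Algebraic distances\<close>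

lemma tendsto_coordinate:
  fixes k :: "'n::finite"
  assumes n: "CARD('n) > 1"
  shows "((\<lambda>f. axis_coordinate k f s) \<longlongrightarrow> s) unit_filter"
  using tendsto_inner_unit_filter[OF n, of "s *\<^sub>R axis k 1" 0 "1 *\<^sub>R axis k 1" 0]
  by (simp add: axis_coordinate_def axis_displacement_def inner_axis_axis)

text \<open>The coordinate of s is forced to be a root of p as well. The other roots form a finite,
  hence closed, set avoiding s, and convergence to s excludes them.\<close>

lemma eventually_coordinate_algebraic:
  fixes k :: "'n::finite"
  assumes n: "CARD('n) > 1" and s: "algebraic s"
  shows "eventually (\<lambda>f. axis_coordinate k f s = s) unit_filter"
proof -
  obtain p where p: "\<And>i. coeff p i \<in> \<int>" "p \<noteq> 0" "poly p s = 0"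
    using s by (auto simp: algebraic_def)
  define T where "T = {x. poly p x = 0} - {s}"
  have "finite T" using poly_roots_finite[OF p(2)] by (simp add: T_def)
  then have "open (- T)" by (simp add: finite_imp_closed open_Compl)
  then have "eventually (\<lambda>f. axis_coordinate k f s \<in> - T) unit_filter"
    by (rule topological_tendstoD[OF tendsto_coordinate[OF n]]) (simp add: T_def)
  then show ?thesis
    using eventually_coordinate_poly[OF n p(1), of k s] unfolding p(3)
    by eventually_elim (auto simp: T_def)
qed

lemma rigid_algebraic:
  assumes n: "CARD('n::finite) > 1" and s: "algebraic s" "s \<ge> 0"
  shows "rigid TYPE('n) s"
proof -
  fix k :: 'n
  have "eventually (\<lambda>f. dist (f (s *\<^sub>R axis k 1)) (f 0) = s) unit_filter"
    using eventually_coordinate_algebraic[OF n s(1), of k] eventually_displacement_line[OF n, of k s]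
      eventually_displacement_unit[of k]
  proof eventually_elim
    case (elim f)
    have "norm (axis_displacement k f 1) = 1" using elim(3) by (simp add: norm_eq_sqrt_inner)
    then have "norm (axis_displacement k f s) = s" using elim(1,2) s(2) by simp
    then show ?case by (simp add: axis_displacement_def dist_norm)
  qed
  moreover have "dist (s *\<^sub>R axis k 1 :: real ^ 'n) 0 = s" using s(2) by simp
  ultimately show ?thesis by (rule rigidI)
qed

theorem theorem1:
  fixes x y :: "real ^ 'n"
  assumes "CARD('n) > 1"
    and "algebraic (norm (x - y))"
  shows "\<exists>S :: (real ^ 'n) set. finite S \<and> x \<in> S \<and> y \<in> S \<and>
    (\<forall>f :: real ^ 'n \<Rightarrow> real ^ 'n.
      preserves_unit_distances_on S f \<longrightarrow> norm (f x - f y) = norm (x - y))"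
proof -
  have "rigid TYPE('n) (norm (x - y))"
    by (rule rigid_algebraic[OF assms]) simp
  then have "eventually (\<lambda>f. dist (f x) (f y) = norm (x - y)) unit_filter"
    by (rule rigidD) (simp add: dist_norm)
  then obtain S where S: "finite S"
      "\<And>f. preserves_unit_distances_on S f \<Longrightarrow> dist (f x) (f y) = norm (x - y)"
    unfolding eventually_unit_filter by blast
  \<comment> \<open>Adding x and y to S only strengthens the condition on \<open>f\<close>.\<close>
  have "preserves_unit_distances_on S f" if "preserves_unit_distances_on (S \<union> {x, y}) f" for f
    using that by (simp add: preserves_unit_distances_on_def)
  with S show ?thesis
    by (intro exI[of _ "S \<union> {x, y}"]) (auto simp: dist_norm)
qed

end
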